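(* Let $\mathcal{S}$ be a nonempty set and let $X$ and $Y$ be lenses with source $\mathcal{S}$ and views $V_1$ and $V_2$ respectively. Then $X\approx Y$ (lens equivalence) if and only if $X^\sim=Y^\sim$.
   Context: A lens $X$ with view $V$ and source $\mathcal{S}$ consists of functions $\mathrm{get}_X:\mathcal{S}\to V$ and $\mathrm{put}_X:V\to\mathcal{S}\to\mathcal{S}$ satisfying, for all $s\in\mathcal{S}$ and $v,v'\in V$: $\mathrm{get}_X(\mathrm{put}_X\,v\,s)=v$, $\mathrm{put}_X\,v\,(\mathrm{put}_X\,v'\,s)=\mathrm{put}_X\,v\,s$, and $\mathrm{put}_X\,(\mathrm{get}_X\,s)\,s=s$. Composition: if $Z$ is a lens with view $V_1$ and source $V_2$, and $Y$ is a lens with view $V_2$ and source $\mathcal{S}$, then $Z\mathbin{;}Y$ is the lens with view $V_1$ and source $\mathcal{S}$ given by $\mathrm{get}\,s=\mathrm{get}_Z(\mathrm{get}_Y\,s)$ and $\mathrm{put}\,v\,s=\mathrm{put}_Y\,(\mathrm{put}_Z\,v\,(\mathrm{get}_Y\,s))\,s$. Sublens: for lenses $X$ (view $V_1$) and $Y$ (view $V_2$) with source $\mathcal{S}$, $X\preceq Y$ iff there is a lens $Z$ with view $V_1$ and source $V_2$ such that $X=Z\mathbin{;}Y$. Lens equivalence: $X\approx Y$ iff $X\preceq Y$ and $Y\preceq X$. The scene of a lens $X$ is the function $X^\sim:\mathcal{S}\to\mathcal{S}\to\mathcal{S}$, $X^\sim=(\lambda s_1\,s_2.\ \mathrm{put}_X\,(\mathrm{get}_X\,s_2)\,s_1)$;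 equality of scenes is equality of these functions. *)

theory Defs
  imports Main
begin

record ('v, 's) lens =
  lens_get :: "'s \<Rightarrow> 'v"
  lens_put :: "'v \<Rightarrow> 's \<Rightarrow> 's"

text \<open>The record type only carries the raw pair of functions; the lens laws are the
  following predicate.  It cannot be turned into a subtype, since the laws force
  \<open>lens_get\<close> to be surjective, so that for some view and source types there are no lenses.\<close>

definition is_lens :: "('v, 's) lens \<Rightarrow> bool" where
  "is_lens X \<longleftrightarrow>
     (\<forall>s v. lens_get X (lens_put X v s) = v) \<and>
     (\<forall>s v v'. lens_put X v (lens_put X v' s) = lens_put X v s) \<and>
     (\<forall>s. lens_put X (lens_get X s) s = s)"

definition lens_comp :: "('a, 'b) lens \<Rightarrow> ('b, 's) lens \<Rightarrow> ('a, 's) lens"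
    (infixl \<open>;\<^sub>L\<close> 80) where
  "Z ;\<^sub>L Y =
     \<lparr> lens_get = (\<lambda>s. lens_get Z (lens_get Y s)),
       lens_put = (\<lambda>v s. lens_put Y (lens_put Z v (lens_get Y s)) s) \<rparr>"

lemma is_lens_comp: "is_lens Z \<Longrightarrow> is_lens Y \<Longrightarrow> is_lens (Z ;\<^sub>L Y)"
  by (simp add: is_lens_def lens_comp_def)

definition sublens :: "('a, 's) lens \<Rightarrow> ('b, 's) lens \<Rightarrow> bool"
    (infix \<open>\<preceq>\<^sub>L\<close> 50) where
  "X \<preceq>\<^sub>L Y \<longleftrightarrow> (\<exists>Z :: ('a, 'b) lens. is_lens Z \<and> X = Z ;\<^sub>L Y)"

definition lens_equiv :: "('a, 's) lens \<Rightarrow> ('b, 's) lens \<Rightarrow> bool"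
    (infix \<open>\<approx>\<^sub>L\<close> 50) where
  "X \<approx>\<^sub>L Y \<longleftrightarrow> X \<preceq>\<^sub>L Y \<and> Y \<preceq>\<^sub>L X"

definition scene :: "('v, 's) lens \<Rightarrow> 's \<Rightarrow> 's \<Rightarrow> 's" where
  "scene X = (\<lambda>s1 s2. lens_put X (lens_get X s2) s1)"

end

(* If X = Z ; Y and Y = W ; X, then the get of W is a left inverse of the get of Z, since the get
   of Y is surjective. So Z has an injective get, which forces its put to ignore the old value,
   and the scenes of X and Y agree. Conversely, fix s0: sending a view v of Y to
   the state put_Y v s0 and applying X there gives a lens Z with X = Z ; Y when the scenes are
   equal. *)
theory Submission imports Defs begin

lemma get_put: "is_lens X \<Longrightarrow> lens_get X (lens_put X v s) = v"
  and put_put: "is_lens X \<Longrightarrow> lens_put X v (lens_put X v' s) = lens_put X v s"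
  by (simp_all add: is_lens_def)

lemma get_comp [simp]: "lens_get (Z ;\<^sub>L Y) s = lens_get Z (lens_get Y s)"
  and put_comp [simp]: "lens_put (Z ;\<^sub>L Y) v s = lens_put Y (lens_put Z v (lens_get Y s)) s"
  by (simp_all add: lens_comp_def)

lemma scene_eq_iff:
  "scene X = scene Y \<longleftrightarrow>
    (\<forall>s s'. lens_put X (lens_get X s') s = lens_put Y (lens_get Y s') s)"
  by (simp add: scene_def fun_eq_iff)

lemma lens_equiv_imp_scene_eq:
  assumes Y: "is_lens Y" and "X \<approx>\<^sub>L Y"
  shows "scene X = scene Y"
proof -
  obtain Z W where Z: "is_lens Z" "X = Z ;\<^sub>L Y" and W: "is_lens W" "Y = W ;\<^sub>L X"
    using assms by (auto simp: lens_equiv_def sublens_def)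
  have WZ: "lens_get W (lens_get Z v) = v" for v
    by (metis get_comp get_put Y Z(2) W(2))
  \<comment> \<open>Both sides have the same image under \<open>lens_get Z\<close>, which
    \<open>WZ\<close> makes injective.\<close>
  have "lens_put Z (lens_get Z v) v' = v" for v v'
    by (metis WZ get_put Z(1))
  then show ?thesis
    by (simp add: scene_eq_iff Z(2))
qed

lemma scene_eq_imp_sublens:
  fixes X :: "('a, 's) lens" and Y :: "('b, 's) lens"
  assumes X: "is_lens X" and Y: "is_lens Y" and "scene X = scene Y"
  shows "X \<preceq>\<^sub>L Y"
proof -
  fix s0 :: 's
  have swap: "lens_put Y (lens_get Y s') s = lens_put X (lens_get X s') s" for s s'
    using assms(3) by (simp add: scene_eq_iff)
  \<comment> \<open>With \<open>s' = lens_put Y v s\<close>, \<open>v\<close> is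
    \<open>lens_get Y s'\<close>, so \<open>swap\<close> turns the inner put into a put of
    \<open>X\<close>, which the outer one overwrites.\<close>
  have put_X_put_Y: "lens_put X u (lens_put Y v s) = lens_put X u s" for u v s
    by (metis swap get_put [OF Y] put_put [OF X])
  define Z :: "('a, 'b) lens" where
    "Z = \<lparr> lens_get = (\<lambda>v. lens_get X (lens_put Y v s0)),
           lens_put = (\<lambda>u v. lens_get Y (lens_put X u (lens_put Y v s0))) \<rparr>"
  have put_get_Z: "lens_get Y (lens_put X (lens_get X (lens_put Y v s0)) s0) = v" for v
    by (metis swap get_put [OF Y])
  have "is_lens Z"
    by (simp add: is_lens_def Z_def swap put_X_put_Y put_get_Z get_put [OF X])
  \<comment> \<open>By \<open>swap\<close> every put of \<open>Y\<close> here becomes one of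
    \<open>X\<close>, and the put-get law of \<open>X\<close> then eliminates
    \<open>s0\<close>.\<close>
  moreover have "X = Z ;\<^sub>L Y"
    by (rule lens.equality) (simp_all add: fun_eq_iff Z_def swap put_X_put_Y get_put [OF X])
  ultimately show ?thesis
    unfolding sublens_def by blast
qed

theorem theorem12:
  fixes X :: "('a, 's) lens" and Y :: "('b, 's) lens"
  assumes "is_lens X" and "is_lens Y"
  shows "X \<approx>\<^sub>L Y \<longleftrightarrow> scene X = scene Y"
  using assms lens_equiv_imp_scene_eq scene_eq_imp_sublens
  unfolding lens_equiv_def by metis

end
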